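(* Let $(U,g)$ be a metric structure and $\lambda$ the Levi-Civita connection field on $U$. For every $a$, the $g$-symmetric and $g$-skew-symmetric parts of $\lambda_a$, namely $\lambda_{a\pm(g)}=\frac12(\lambda_a\pm\lambda_a^{\dagger(g)})$, are given by $$\lambda_{a+(g)}(b)=\tfrac12\,g^{-1}\circ(a\cdot\partial_og)(b),\qquad \lambda_{a-(g)}(b)=\omega_0(a)\times_gb .$$
   Context: $M$ is an $n$-dimensional smooth manifold, $(U_o,\phi_o)$ a chart with coordinates $x^1,\dots,x^n$, and $U\subset U_o$ open. The canonical space $\mathcal{U}_o$ is an $n$-dimensional real vector space with basis $b_1,\dots,b_n$ and the Euclidean scalar product $b_\mu\cdot b_\nu=\delta_{\mu\nu}$. For $a\in\mathcal{U}_o$, $a\cdot\partial_o=\sum_\mu(a\cdot b_\mu)\,\partial/\partial x^\mu$ (componentwise); for a smooth field $g$ of endomorphisms of $\mathcal{U}_o$, $(a\cdot\partial_og)(b)=a\cdot\partial_o(g(b))-g(a\cdot\partial_ob)$. A metric structure $(U,g)$: $g$ is a smooth field of endomorphisms of $\mathcal{U}_o$ on $U$, symmetric with respect to the Euclidean scalar product and with $\det[g]\ne0$ everywhere. $v\cdot_gw=g(v)\cdot w$. For a bivector $B$ and vector $b$, $B\times_gb$ is half the commutator in the $g$-Clifford algebra, which equals $-g(b)\lrcorner B$, where $v\lrcorner(x\wedge y)=(v\cdot x)y-(v\cdot y)x$. The metric adjoint $t^{\dagger(g)}$ of an endomorphism $t$ is defined by $t^{\dagger(g)}(b)\cdot_gc=b\cdot_gt(c)$.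 Levi-Civita connection field: $\lambda(a,b)=\lambda_a(b)=\frac12g^{-1}\circ(a\cdot\partial_og)(b)+\omega_0(a)\times_gb$, where $\omega_0(a)=-\frac14\sum_{\mu,\nu}a\cdot\bigl((b_\mu\cdot\partial_og)(b_\nu)-(b_\nu\cdot\partial_og)(b_\mu)\bigr)\,g^{-1}(b_\mu)\wedge g^{-1}(b_\nu)$. *)

theory Defs
  imports "HOL-Analysis.Analysis"
begin

section \<open>Smooth manifolds and smooth fields\<close>

text \<open>\<open>S\<close> is meant to be an open subset of a finite-dimensional space.\<close>

primrec Ck_on :: "nat \<Rightarrow> ('a::real_normed_vector \<Rightarrow> 'b::real_normed_vector) \<Rightarrow> 'a set \<Rightarrow> bool" where
  "Ck_on 0 f S \<longleftrightarrow> continuous_on S f"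
| "Ck_on (Suc k) f S \<longleftrightarrow> (\<forall>x\<in>S. f differentiable (at x)) \<and>
     (\<forall>v. Ck_on k (\<lambda>x. frechet_derivative f (at x) v) S)"

definition smooth_on :: "('a::real_normed_vector \<Rightarrow> 'b::real_normed_vector) \<Rightarrow> 'a set \<Rightarrow> bool" where
  "smooth_on f S \<longleftrightarrow> (\<forall>k. Ck_on k f S)"

text \<open>The canonical space, with its standard basis and its standard inner product.\<close>

type_synonym 'n canonical = "real ^ 'n"

type_synonym ('m, 'n) chart = "'m set \<times> ('m \<Rightarrow> 'n canonical)"

text \<open>The inverse of the chart map; only its values on \<open>snd c ` fst c\<close> are meaningful.\<close>

definition chart_inv :: "('m, 'n::finite) chart \<Rightarrow> 'n canonical \<Rightarrow> 'm" where
  "chart_inv c = inv_into (fst c) (snd c)"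

definition is_chart :: "'m topology \<Rightarrow> ('m, 'n::finite) chart \<Rightarrow> bool" where
  "is_chart X c \<longleftrightarrow> openin X (fst c) \<and> open (snd c ` fst c) \<and>
     homeomorphic_map (subtopology X (fst c)) (top_of_set (snd c ` fst c)) (snd c)"

definition charts_compatible :: "('m, 'n::finite) chart \<Rightarrow> ('m, 'n) chart \<Rightarrow> bool" where
  "charts_compatible c d \<longleftrightarrow>
     smooth_on (snd d \<circ> chart_inv c) (snd c ` (fst c \<inter> fst d)) \<and>
     smooth_on (snd c \<circ> chart_inv d) (snd d ` (fst c \<inter> fst d))"

definition smooth_manifold :: "'m topology \<Rightarrow> ('m, 'n::finite) chart set \<Rightarrow> bool" where
  "smooth_manifold X A \<longleftrightarrow>
     Hausdorff_space X \<and>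
     (\<exists>\<B>. countable \<B> \<and> (\<forall>V\<in>\<B>. openin X V) \<and>
        (\<forall>W x. openin X W \<and> x \<in> W \<longrightarrow> (\<exists>V\<in>\<B>. x \<in> V \<and> V \<subseteq> W))) \<and>
     (\<forall>c\<in>A. is_chart X c) \<and>
     (\<Union>c\<in>A. fst c) = topspace X \<and>
     (\<forall>c\<in>A. \<forall>d\<in>A. charts_compatible c d) \<and>
     (\<forall>c. is_chart X c \<and> (\<forall>d\<in>A. charts_compatible c d) \<longrightarrow> c \<in> A)"

definition smooth_field :: "('m, 'n::finite) chart set \<Rightarrow> 'm set \<Rightarrow> ('m \<Rightarrow> 'b::real_normed_vector) \<Rightarrow> bool" where
  "smooth_field A U f \<longleftrightarrow> (\<forall>c\<in>A. smooth_on (f \<circ> chart_inv c) (snd c ` (U \<inter> fst c)))"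


section \<open>Directional derivatives\<close>

abbreviation (input) basis_vec :: "'n::finite \<Rightarrow> 'n canonical" where
  "basis_vec \<mu> \<equiv> axis \<mu> 1"

definition partial_deriv :: "('m, 'n::finite) chart \<Rightarrow> 'n \<Rightarrow> ('m \<Rightarrow> 'b::real_normed_vector) \<Rightarrow> 'm \<Rightarrow> 'b" where
  "partial_deriv c \<mu> f p =
     vector_derivative (\<lambda>t. f (chart_inv c (snd c p + t *\<^sub>R basis_vec \<mu>))) (at 0)"

definition dir_deriv :: "('m, 'n::finite) chart \<Rightarrow> 'n canonical \<Rightarrow> ('m \<Rightarrow> 'b::real_normed_vector) \<Rightarrow> 'm \<Rightarrow> 'b" where
  "dir_deriv c a f p = (\<Sum>\<mu>\<in>UNIV. (a \<bullet> basis_vec \<mu>) *\<^sub>R partial_deriv c \<mu> f p)"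

text \<open>For a vector field \<open>b\<close>, the vector field \<open>(a \<cdot> \<partial>\<^sub>o g)(b)\<close>.\<close>

definition endo_deriv ::
  "('m, 'n::finite) chart \<Rightarrow> 'n canonical \<Rightarrow> ('m \<Rightarrow> 'n canonical \<Rightarrow>\<^sub>L 'n canonical) \<Rightarrow> ('m \<Rightarrow> 'n canonical) \<Rightarrow> 'm \<Rightarrow> 'n canonical" where
  "endo_deriv c a g b p = dir_deriv c a (\<lambda>q. g q (b q)) p - g p (dir_deriv c a b p)"


section \<open>Exterior algebra and metric Clifford algebra\<close>

text \<open>
  A multivector is given by its components with respect to the basis
  \<open>b\<^sub>I = b\<^bsub>i\<^sub>1\<^esub> \<and> \<dots> \<and> b\<^bsub>i\<^sub>k\<^esub>\<close>, where \<open>I = {i\<^sub>1 < \<dots> < i\<^sub>k}\<close>;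
  this is what the order on the index type is used for.
\<close>

type_synonym 'n multivector = "real ^ ('n set)"

definition vec_embed :: "'n canonical \<Rightarrow> 'n::finite multivector" where
  "vec_embed v = (\<Sum>\<mu>\<in>UNIV. (v $ \<mu>) *\<^sub>R axis {\<mu>} 1)"

definition vec_part :: "'n::finite multivector \<Rightarrow> 'n canonical" where
  "vec_part Z = (\<chi> \<mu>. Z $ {\<mu>})"

text \<open>The sign of moving \<open>b\<^sub>\<mu>\<close> from the front to its place among the factors of \<open>b\<^sub>I\<close>.\<close>

definition blade_sign :: "'n::{finite,linorder} set \<Rightarrow> 'n \<Rightarrow> real" where
  "blade_sign I \<mu> = (- 1) ^ card {\<nu>\<in>I. \<nu> < \<mu>}"

definition wedge_vec :: "'n canonical \<Rightarrow> 'n::{finite,linorder} multivector \<Rightarrow> 'n multivector" where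
  "wedge_vec v Z = (\<chi> I. \<Sum>\<mu>\<in>I. blade_sign I \<mu> * v $ \<mu> * Z $ (I - {\<mu>}))"

definition left_contract :: "'n canonical \<Rightarrow> 'n::{finite,linorder} multivector \<Rightarrow> 'n multivector" where
  "left_contract v Z = (\<chi> I. \<Sum>\<mu>\<in>-I. blade_sign I \<mu> * v $ \<mu> * Z $ (insert \<mu> I))"

abbreviation wedge2 :: "'n canonical \<Rightarrow> 'n canonical \<Rightarrow> 'n::{finite,linorder} multivector" where
  "wedge2 x y \<equiv> wedge_vec x (vec_embed y)"

text \<open>Clifford product of a vector and a multivector: \<open>v Z = v \<and> Z + v \<lrcorner>\<^sub>g Z\<close>,
  where \<open>v \<lrcorner>\<^sub>g Z = g(v) \<lrcorner> Z\<close>.\<close>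

definition clifford_vec ::
  "('n canonical \<Rightarrow> 'n canonical) \<Rightarrow> 'n canonical \<Rightarrow> 'n::{finite,linorder} multivector \<Rightarrow> 'n multivector" where
  "clifford_vec G v Z = wedge_vec v Z + left_contract (G v) Z"

text \<open>In the Clifford algebra \<open>b\<^sub>I\<close> is the antisymmetrized product
  \<open>(1/k!) \<Sum>\<^sub>\<sigma> sign \<sigma> b\<^bsub>\<sigma> i\<^sub>1\<^esub> \<cdots> b\<^bsub>\<sigma> i\<^sub>k\<^esub>\<close>
  (the \<open>b\<^sub>\<mu>\<close> need not be orthogonal for the metric).\<close>

definition clifford_blade ::
  "('n canonical \<Rightarrow> 'n canonical) \<Rightarrow> 'n set \<Rightarrow> 'n::{finite,linorder} multivector \<Rightarrow> 'n multivector" where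
  "clifford_blade G I Z = (1 / fact (card I)) *\<^sub>R (\<Sum>\<sigma> | \<sigma> permutes I.
     of_int (sign \<sigma>) *\<^sub>R
       foldr (\<lambda>\<mu>. clifford_vec G (basis_vec (\<sigma> \<mu>))) (sorted_list_of_set I) Z)"

definition clifford_prod ::
  "('n canonical \<Rightarrow> 'n canonical) \<Rightarrow> 'n::{finite,linorder} multivector \<Rightarrow> 'n multivector \<Rightarrow> 'n multivector" where
  "clifford_prod G Y Z = (\<Sum>I\<in>UNIV. (Y $ I) *\<^sub>R clifford_blade G I Z)"

definition commutator_prod ::
  "('n canonical \<Rightarrow> 'n canonical) \<Rightarrow> 'n::{finite,linorder} multivector \<Rightarrow> 'n multivector \<Rightarrow> 'n multivector" where
  "commutator_prod G Y Z = (1 / 2) *\<^sub>R (clifford_prod G Y Z - clifford_prod G Z Y)"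

text \<open>For a bivector \<open>B\<close> and a vector \<open>b\<close>, \<open>commutator_prod G B (vec_embed b)\<close> is a vector;
  see \<open>commutator_prod_wedge2\<close> and \<open>left_contract_wedge2\<close> below.\<close>

definition bivector_cross ::
  "('n canonical \<Rightarrow> 'n canonical) \<Rightarrow> 'n::{finite,linorder} multivector \<Rightarrow> 'n canonical \<Rightarrow> 'n canonical" where
  "bivector_cross G B b = vec_part (commutator_prod G B (vec_embed b))"

lemma wedge_vec_bilinear:
  "wedge_vec (x + y) Z = wedge_vec x Z + wedge_vec y Z"
  "wedge_vec (r *\<^sub>R x) Z = r *\<^sub>R wedge_vec x Z"
  "wedge_vec x (Y + Z) = wedge_vec x Y + wedge_vec x Z"
  "wedge_vec x (r *\<^sub>R Z) = r *\<^sub>R wedge_vec x Z"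
  by (simp_all add: wedge_vec_def vec_eq_iff algebra_simps sum.distrib sum_distrib_left)

lemma left_contract_bilinear:
  "left_contract (x + y) Z = left_contract x Z + left_contract y Z"
  "left_contract (r *\<^sub>R x) Z = r *\<^sub>R left_contract x Z"
  "left_contract x (Y + Z) = left_contract x Y + left_contract x Z"
  "left_contract x (r *\<^sub>R Z) = r *\<^sub>R left_contract x Z"
  by (simp_all add: left_contract_def vec_eq_iff algebra_simps sum.distrib sum_distrib_left)

lemma vec_embed_linear:
  "vec_embed (x + y) = vec_embed x + vec_embed y"
  "vec_embed (r *\<^sub>R x) = r *\<^sub>R vec_embed x"
  by (simp_all add: vec_embed_def algebra_simps sum.distrib scaleR_sum_right)

lemma vec_embed_nth: "vec_embed x $ I = (\<Sum>\<mu>\<in>UNIV. if I = {\<mu>} then x $ \<mu> else 0)"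
  by (auto simp: vec_embed_def axis_def intro!: sum.cong)

lemma vec_embed_singleton [simp]: "vec_embed x $ {\<mu>} = x $ \<mu>"
  by (simp add: vec_embed_nth)

lemma vec_embed_not_singleton: "(\<And>\<mu>. I \<noteq> {\<mu>}) \<Longrightarrow> vec_embed x $ I = 0"
  by (simp add: vec_embed_nth)

lemma vec_embed_basis: "vec_embed (basis_vec \<mu>) = axis {\<mu>} 1"
  by (simp add: vec_eq_iff vec_embed_nth axis_def)
     (auto simp: if_distrib if_distribR cong: if_cong)

lemma vec_part_embed [simp]: "vec_part (vec_embed x) = x"
  by (simp add: vec_part_def vec_eq_iff)

lemma blade_sign_remove:
  assumes "\<mu> \<in> I"
  shows "blade_sign (I - {\<mu>}) \<nu> = (if \<mu> < \<nu> then - blade_sign I \<nu> else blade_sign I \<nu>)"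
proof -
  have eq: "{i \<in> I - {\<mu>}. i < \<nu>} = {i \<in> I. i < \<nu>} - {\<mu>}" by auto
  show ?thesis
  proof (cases "\<mu> < \<nu>")
    case True
    then have "card {i \<in> I. i < \<nu>} = Suc (card ({i \<in> I. i < \<nu>} - {\<mu>}))"
      using assms by (subst card_Suc_Diff1) auto
    then show ?thesis using True unfolding blade_sign_def eq by simp
  next
    case False
    then have "{i \<in> I. i < \<nu>} - {\<mu>} = {i \<in> I. i < \<nu>}" by auto
    then show ?thesis using False unfolding blade_sign_def eq by simp
  qed
qed

lemma blade_sign_insert:
  assumes "\<mu> \<notin> I"
  shows "blade_sign (insert \<mu> I) \<nu> = (if \<mu> < \<nu> then - blade_sign I \<nu> else blade_sign I \<nu>)"
  using blade_sign_remove[of \<mu> "insert \<mu> I" \<nu>] assms by (simp split: if_splits)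

lemma blade_sign_square [simp]: "blade_sign I \<mu> * blade_sign I \<mu> = 1"
  by (simp add: blade_sign_def flip: power_add mult_2)

lemma wedge_vec_anticommute:
  fixes Z :: "'n::{finite,linorder} multivector"
  shows "wedge_vec x (wedge_vec y Z) = - wedge_vec y (wedge_vec x Z)"
proof -
  define T where "T = (\<lambda>x y I \<mu> \<nu>. if \<mu> = \<nu> then 0 else
    blade_sign I \<mu> * x $ \<mu> * (blade_sign (I - {\<mu>}) \<nu> * y $ \<nu> * Z $ (I - {\<mu>} - {\<nu>})))"
  have W: "wedge_vec x (wedge_vec y Z) $ I = (\<Sum>\<mu>\<in>I. \<Sum>\<nu>\<in>I. T x y I \<mu> \<nu>)" for x y I
    unfolding wedge_vec_def T_def
    by (simp add: sum_distrib_left)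
       (intro sum.cong refl sum.mono_neutral_cong_left; auto)
  have "T x y I \<mu> \<nu> = - T y x I \<nu> \<mu>" if "\<mu> \<in> I" "\<nu> \<in> I" for I \<mu> \<nu>
    using that by (auto simp: T_def blade_sign_remove insert_commute Diff_insert2[symmetric])
  then have "(\<Sum>\<mu>\<in>I. \<Sum>\<nu>\<in>I. T x y I \<mu> \<nu>) = - (\<Sum>\<mu>\<in>I. \<Sum>\<nu>\<in>I. T y x I \<mu> \<nu>)" for I
    by (subst (2) sum.swap) (simp add: sum_negf)
  then show ?thesis by (simp add: vec_eq_iff W)
qed

lemma left_contract_wedge:
  "left_contract v (wedge_vec x Z) = (v \<bullet> x) *\<^sub>R Z - wedge_vec x (left_contract v Z)"
proof -
  have "left_contract v (wedge_vec x Z) $ I + wedge_vec x (left_contract v Z) $ I = (v \<bullet> x) * Z $ I"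
    for I
  proof -
    define T where "T = (\<lambda>\<mu> \<nu>. blade_sign I \<mu> * v $ \<mu> *
      (blade_sign (insert \<mu> I) \<nu> * x $ \<nu> * Z $ (insert \<mu> I - {\<nu>})))"
    have "left_contract v (wedge_vec x Z) $ I = (\<Sum>\<mu>\<in>-I. \<Sum>\<nu>\<in>insert \<mu> I. T \<mu> \<nu>)"
      by (simp add: left_contract_def wedge_vec_def T_def sum_distrib_left del: sum.insert)
    also have "\<dots> = (\<Sum>\<mu>\<in>-I. v $ \<mu> * x $ \<mu> * Z $ I + (\<Sum>\<nu>\<in>I. T \<mu> \<nu>))"
    proof (intro sum.cong refl)
      fix \<mu> assume "\<mu> \<in> - I"
      then have "(\<Sum>\<nu>\<in>insert \<mu> I. T \<mu> \<nu>) = T \<mu> \<mu> + (\<Sum>\<nu>\<in>I. T \<mu> \<nu>)" by simp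
      also have "T \<mu> \<mu> = (blade_sign I \<mu> * blade_sign I \<mu>) * (v $ \<mu> * x $ \<mu> * Z $ I)"
        using \<open>\<mu> \<in> - I\<close> unfolding T_def by (simp add: blade_sign_insert del: blade_sign_square)
      finally show "(\<Sum>\<nu>\<in>insert \<mu> I. T \<mu> \<nu>) = v $ \<mu> * x $ \<mu> * Z $ I + (\<Sum>\<nu>\<in>I. T \<mu> \<nu>)"
        by simp
    qed
    finally have 1: "left_contract v (wedge_vec x Z) $ I
      = (\<Sum>\<mu>\<in>-I. v $ \<mu> * x $ \<mu> * Z $ I) + (\<Sum>\<mu>\<in>-I. \<Sum>\<nu>\<in>I. T \<mu> \<nu>)"
      by (simp add: sum.distrib)
    define R where "R = (\<lambda>\<nu> \<mu>. blade_sign I \<nu> * x $ \<nu> *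
      (blade_sign (I - {\<nu>}) \<mu> * v $ \<mu> * Z $ (insert \<mu> (I - {\<nu>}))))"
    have "wedge_vec x (left_contract v Z) $ I = (\<Sum>\<nu>\<in>I. \<Sum>\<mu>\<in>-(I - {\<nu>}). R \<nu> \<mu>)"
      unfolding left_contract_def wedge_vec_def R_def by (simp only: vec_lambda_beta sum_distrib_left)
    also have "\<dots> = (\<Sum>\<nu>\<in>I. v $ \<nu> * x $ \<nu> * Z $ I + (\<Sum>\<mu>\<in>-I. - T \<mu> \<nu>))"
    proof (intro sum.cong refl)
      fix \<nu> assume \<nu>: "\<nu> \<in> I"
      have "- (I - {\<nu>}) = insert \<nu> (- I)" using \<nu> by auto
      then have "(\<Sum>\<mu>\<in>-(I - {\<nu>}). R \<nu> \<mu>) = R \<nu> \<nu> + (\<Sum>\<mu>\<in>-I. R \<nu> \<mu>)" using \<nu> by simp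
      also have "R \<nu> \<nu> = (blade_sign I \<nu> * blade_sign I \<nu>) * (v $ \<nu> * x $ \<nu> * Z $ I)"
        using \<nu> unfolding R_def by (simp add: blade_sign_remove insert_absorb del: blade_sign_square)
      also have "(\<Sum>\<mu>\<in>-I. R \<nu> \<mu>) = (\<Sum>\<mu>\<in>-I. - T \<mu> \<nu>)"
      proof (intro sum.cong refl)
        fix \<mu> assume \<mu>: "\<mu> \<in> - I"
        then have "\<mu> \<noteq> \<nu>" using \<nu> by auto
        then have ins: "insert \<mu> (I - {\<nu>}) = insert \<mu> I - {\<nu>}" by auto
        have s1: "blade_sign (insert \<mu> I) \<nu> = (if \<mu> < \<nu> then - blade_sign I \<nu> else blade_sign I \<nu>)"
          using \<mu> by (intro blade_sign_insert) simp
        have s2: "blade_sign (I - {\<nu>}) \<mu> = (if \<nu> < \<mu> then - blade_sign I \<mu> else blade_sign I \<mu>)"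
          using \<nu> by (rule blade_sign_remove)
        show "R \<nu> \<mu> = - T \<mu> \<nu>"
          unfolding R_def T_def ins s1 s2
          using \<open>\<mu> \<noteq> \<nu>\<close> by (cases \<mu> \<nu> rule: linorder_cases) (simp_all add: order_less_not_sym)
      qed
      finally show "(\<Sum>\<mu>\<in>-(I - {\<nu>}). R \<nu> \<mu>) = v $ \<nu> * x $ \<nu> * Z $ I + (\<Sum>\<mu>\<in>-I. - T \<mu> \<nu>)"
        by simp
    qed
    finally have 2: "wedge_vec x (left_contract v Z) $ I
      = (\<Sum>\<nu>\<in>I. v $ \<nu> * x $ \<nu> * Z $ I) - (\<Sum>\<nu>\<in>I. \<Sum>\<mu>\<in>-I. T \<mu> \<nu>)"
      by (simp add: sum.distrib sum_negf sum_subtractf)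
    have "(\<Sum>\<mu>\<in>-I. v $ \<mu> * x $ \<mu> * Z $ I) + (\<Sum>\<mu>\<in>I. v $ \<mu> * x $ \<mu> * Z $ I)
      = (\<Sum>\<mu>\<in>UNIV. v $ \<mu> * x $ \<mu> * Z $ I)"
      using sum.union_disjoint[of "- I" I "\<lambda>\<mu>. v $ \<mu> * x $ \<mu> * Z $ I"]
      by (simp add: Compl_partition2)
    also have "\<dots> = (v \<bullet> x) * Z $ I"
      by (simp add: inner_vec_def sum_distrib_right)
    finally show ?thesis
      using sum.swap[of T I "- I"] unfolding 1 2 by simp
  qed
  then show ?thesis by (simp add: vec_eq_iff eq_diff_eq)
qed

lemma left_contract_vec_embed: "left_contract v (vec_embed w) = (v \<bullet> w) *\<^sub>R axis {} 1"
proof (unfold vec_eq_iff, rule allI)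
  fix I
  show "left_contract v (vec_embed w) $ I = ((v \<bullet> w) *\<^sub>R axis {} 1) $ I"
  proof (cases "I = {}")
    case True
    then show ?thesis
      by (simp add: left_contract_def blade_sign_def inner_vec_def)
  next
    case False
    then have "vec_embed w $ insert \<mu> I = 0" if "\<mu> \<in> - I" for \<mu>
      using that by (intro vec_embed_not_singleton) auto
    then show ?thesis using False by (simp add: left_contract_def axis_def)
  qed
qed

lemma left_contract_one: "left_contract v (axis {} 1) = 0"
  by (simp add: left_contract_def axis_def vec_eq_iff)

lemma wedge_vec_one: "wedge_vec x (axis {} 1) = vec_embed x"
proof (unfold vec_eq_iff, rule allI)
  fix I
  show "wedge_vec x (axis {} 1) $ I = vec_embed x $ I"
  proof (cases "\<exists>\<mu>. I = {\<mu>}")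
    case True
    then obtain \<mu> where I: "I = {\<mu>}" by blast
    have "{\<nu> \<in> {\<mu>}. \<nu> < \<mu>} = {}" by auto
    then have "blade_sign {\<mu>} \<mu> = 1" by (simp only: blade_sign_def card.empty power_0)
    then show ?thesis by (simp add: I wedge_vec_def axis_def)
  next
    case False
    then have "I - {\<mu>} \<noteq> {}" if "\<mu> \<in> I" for \<mu> using that by auto
    with False show ?thesis by (simp add: wedge_vec_def axis_def vec_embed_not_singleton)
  qed
qed

lemma wedge2_anticommute: "wedge2 x y = - wedge2 y x"
  using wedge_vec_anticommute[of x y "axis {} 1"] by (simp add: wedge_vec_one)

lemma left_contract_wedge2:
  "left_contract v (wedge2 x y) = vec_embed ((v \<bullet> x) *\<^sub>R y - (v \<bullet> y) *\<^sub>R x)"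
proof -
  have "vec_embed ((v \<bullet> x) *\<^sub>R y - (v \<bullet> y) *\<^sub>R x)
      = vec_embed ((v \<bullet> x) *\<^sub>R y + (- (v \<bullet> y)) *\<^sub>R x)" by simp
  also have "\<dots> = (v \<bullet> x) *\<^sub>R vec_embed y - (v \<bullet> y) *\<^sub>R vec_embed x"
    by (simp only: vec_embed_linear) simp
  finally show ?thesis
    by (simp add: left_contract_wedge left_contract_vec_embed wedge_vec_bilinear wedge_vec_one)
qed

lemma wedge2_basis:
  assumes "\<mu> < \<nu>"
  shows "wedge2 (basis_vec \<mu>) (basis_vec \<nu>) = axis {\<mu>, \<nu>} 1"
proof (unfold vec_eq_iff, rule allI)
  fix I
  have "wedge2 (basis_vec \<mu>) (basis_vec \<nu>) $ I
      = (\<Sum>\<kappa>\<in>I. if \<kappa> = \<mu> then blade_sign I \<mu> * (if I - {\<mu>} = {\<nu>} then 1 else 0) else 0)"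
    unfolding wedge_vec_def vec_embed_basis vec_lambda_beta
    by (intro sum.cong refl) (simp add: axis_def)
  also have "\<dots> = (if \<mu> \<in> I then blade_sign I \<mu> * (if I - {\<mu>} = {\<nu>} then 1 else 0) else 0)"
    by simp
  also have "\<dots> = (if I = {\<mu>, \<nu>} then blade_sign I \<mu> else 0)"
  proof -
    have iff: "(I = {\<mu>, \<nu>}) = (\<mu> \<in> I \<and> I - {\<mu>} = {\<nu>})" using assms by blast
    show ?thesis unfolding iff by (simp only: if_distrib mult_1_right mult_zero_right) simp
  qed
  also have "\<dots> = axis {\<mu>, \<nu>} 1 $ I"
  proof -
    have "{i \<in> {\<mu>, \<nu>}. i < \<mu>} = {}" using assms by auto
    then have "blade_sign {\<mu>, \<nu>} \<mu> = 1" by (simp only: blade_sign_def card.empty power_0)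
    then show ?thesis by (auto simp: axis_def)
  qed
  finally show "wedge2 (basis_vec \<mu>) (basis_vec \<nu>) $ I = axis {\<mu>, \<nu>} 1 $ I" .
qed

lemma clifford_vec_linear:
  assumes "linear G"
  shows "clifford_vec G (x + y) Z = clifford_vec G x Z + clifford_vec G y Z"
    and "clifford_vec G (r *\<^sub>R x) Z = r *\<^sub>R clifford_vec G x Z"
    and "clifford_vec G x (Y + Z) = clifford_vec G x Y + clifford_vec G x Z"
    and "clifford_vec G x (r *\<^sub>R Z) = r *\<^sub>R clifford_vec G x Z"
  using linear_add[OF assms] linear_cmul[OF assms]
  by (simp_all add: clifford_vec_def wedge_vec_bilinear left_contract_bilinear algebra_simps)

lemma clifford_prod_linear:
  "clifford_prod G (Y + Y') Z = clifford_prod G Y Z + clifford_prod G Y' Z"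
  "clifford_prod G (r *\<^sub>R Y) Z = r *\<^sub>R clifford_prod G Y Z"
  by (simp_all add: clifford_prod_def algebra_simps sum.distrib scaleR_sum_right)

lemma clifford_prod_axis: "clifford_prod G (axis I 1) Z = clifford_blade G I Z"
proof -
  have "clifford_prod G (axis I 1) Z
      = (\<Sum>J\<in>UNIV. if J = I then clifford_blade G I Z else 0)"
    unfolding clifford_prod_def by (intro sum.cong) (auto simp: axis_def)
  then show ?thesis by simp
qed

lemma clifford_blade_singleton: "clifford_blade G {\<mu>} Z = clifford_vec G (basis_vec \<mu>) Z"
proof -
  have "{\<sigma>. \<sigma> permutes {\<mu>}} = {id}" by auto
  then show ?thesis by (simp add: clifford_blade_def)
qed

lemma clifford_blade_pair:
  assumes "\<mu> < \<nu>"
  shows "clifford_blade G {\<mu>, \<nu>} Z = (1 / 2) *\<^sub>R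
    (clifford_vec G (basis_vec \<mu>) (clifford_vec G (basis_vec \<nu>) Z)
     - clifford_vec G (basis_vec \<nu>) (clifford_vec G (basis_vec \<mu>) Z))"
proof -
  have perms: "{\<sigma>. \<sigma> permutes {\<mu>, \<nu>}} = {id, Transposition.transpose \<mu> \<nu>}"
    using assms by (auto simp: permutes_doubleton_iff)
  have ne: "id \<noteq> Transposition.transpose \<mu> \<nu>"
    using assms by (metis id_apply order_less_irrefl transpose_apply_first)
  have "sorted_list_of_set {\<mu>, \<nu>} = [\<mu>, \<nu>]"
    using assms by (intro sorted_list_of_set_unique[THEN iffD1]) auto
  with ne assms show ?thesis
    by (simp add: clifford_blade_def perms sign_swap_id algebra_simps)
qed

lemma clifford_prod_vec:
  assumes "linear G"
  shows "clifford_prod G (vec_embed v) Z = clifford_vec G v Z"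
proof -
  have l1: "linear (\<lambda>v. clifford_prod G (vec_embed v) Z)"
    by (rule linearI) (simp_all add: vec_embed_linear clifford_prod_linear)
  have l2: "linear (\<lambda>v. clifford_vec G v Z)"
    by (rule linearI) (simp_all add: clifford_vec_linear[OF assms])
  have "(\<lambda>v. clifford_prod G (vec_embed v) Z) = (\<lambda>v. clifford_vec G v Z)"
  proof (rule linear_eq_stdbasis[OF l1 l2])
    fix e :: "'a canonical" assume "e \<in> Basis"
    then obtain \<mu> where "e = basis_vec \<mu>" by (auto simp: Basis_vec_def)
    then show "clifford_prod G (vec_embed e) Z = clifford_vec G e Z"
      by (simp add: vec_embed_basis clifford_prod_axis clifford_blade_singleton)
  qed
  then show ?thesis by (rule fun_cong)
qed

lemma clifford_prod_wedge2:
  assumes "linear G"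
  shows "clifford_prod G (wedge2 x y) Z = (1 / 2) *\<^sub>R
    (clifford_vec G x (clifford_vec G y Z) - clifford_vec G y (clifford_vec G x Z))"
proof -
  define F where "F = (\<lambda>x y. clifford_prod G (wedge2 x y) Z)"
  define H where "H = (\<lambda>x y. (1 / 2) *\<^sub>R
    (clifford_vec G x (clifford_vec G y Z) - clifford_vec G y (clifford_vec G x Z)))"
  have F1: "linear (\<lambda>x. F x y)" and F2: "linear (F x)" for x y
    unfolding F_def
    by (rule linearI; simp add: vec_embed_linear wedge_vec_bilinear clifford_prod_linear)+
  have H1: "linear (\<lambda>x. H x y)" and H2: "linear (H x)" for x y
    unfolding H_def
    by (rule linearI; simp add: clifford_vec_linear[OF assms] algebra_simps)+
  have lt: "F (basis_vec \<mu>) (basis_vec \<nu>) = H (basis_vec \<mu>) (basis_vec \<nu>)" if "\<mu> < \<nu>" for \<mu> \<nu>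
    using that by (simp add: F_def H_def wedge2_basis clifford_prod_axis clifford_blade_pair)
  have F_anti: "F x y = - F y x" for x y
    unfolding F_def by (subst wedge2_anticommute)
      (metis clifford_prod_linear(2) scaleR_minus1_left)
  have H_anti: "H x y = - H y x" for x y
    by (simp add: H_def algebra_simps)
  have bas: "F (basis_vec \<mu>) (basis_vec \<nu>) = H (basis_vec \<mu>) (basis_vec \<nu>)" for \<mu> \<nu>
  proof (cases \<mu> \<nu> rule: linorder_cases)
    case less then show ?thesis by (rule lt)
  next
    case equal
    have "F x x = 0" "H x x = 0" for x
      using F_anti[of x x] H_anti[of x x] by (auto simp: vec_eq_iff)
    with equal show ?thesis by simp
  next
    case greater then show ?thesis using lt F_anti H_anti by metis
  qed
  have "F (basis_vec \<mu>) = H (basis_vec \<mu>)" for \<mu>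
    by (rule linear_eq_stdbasis[OF F2 H2]) (auto simp: Basis_vec_def bas)
  then have "(\<lambda>x. F x y) = (\<lambda>x. H x y)" for y
    by (intro linear_eq_stdbasis[OF F1 H1]) (auto simp: Basis_vec_def)
  then show ?thesis by (metis F_def H_def)
qed

text \<open>Half the commutator in the Clifford algebra equals \<open>- g(b) \<lrcorner> B\<close>.\<close>

lemma commutator_prod_wedge2:
  assumes "linear G" and sym: "\<And>v w. G v \<bullet> w = v \<bullet> G w"
  shows "commutator_prod G (wedge2 x y) (vec_embed v) = - left_contract (G v) (wedge2 x y)"
proof -
  have neg: "wedge_vec v (- Z) = - wedge_vec v Z" "left_contract v (- Z) = - left_contract v Z" for v Z
    by (metis scaleR_minus1_left wedge_vec_bilinear(4), metis scaleR_minus1_left left_contract_bilinear(4))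
  have diff: "wedge_vec v (Y - Z) = wedge_vec v Y - wedge_vec v Z" for v Y Z
    using wedge_vec_bilinear(3)[of v Y "- Z"] by (simp add: neg)
  have ve_m: "vec_embed (x - y) = vec_embed x - vec_embed y" for x y
    using vec_embed_linear(1)[of "x - y" y] by (simp add: eq_diff_eq)
  have yx: "wedge_vec y (wedge2 x v) = - wedge_vec x (wedge2 y v)" by (rule wedge_vec_anticommute)
  have vx: "wedge_vec v (wedge2 x y) = wedge_vec x (wedge2 y v)"
    using wedge_vec_anticommute[of v x "vec_embed y"] wedge2_anticommute[of v y] by (simp add: neg)
  have yx2: "G y \<bullet> x = G x \<bullet> y" "G v \<bullet> x = G x \<bullet> v" "G v \<bullet> y = G y \<bullet> v"
    using sym by (metis inner_commute)+
  show ?thesis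
    unfolding commutator_prod_def clifford_prod_wedge2[OF assms(1)] clifford_prod_vec[OF assms(1)]
    by (simp add: clifford_vec_def wedge_vec_bilinear left_contract_bilinear left_contract_vec_embed
        left_contract_wedge2 wedge_vec_one left_contract_wedge left_contract_one yx vx yx2 ve_m vec_embed_linear diff)
       (simp add: vec_eq_iff field_simps)
qed

section \<open>Metric structures and the Levi-Civita connection field\<close>

definition metric_structure ::
  "('m, 'n::finite) chart set \<Rightarrow> 'm set \<Rightarrow> ('m \<Rightarrow> 'n canonical \<Rightarrow>\<^sub>L 'n canonical) \<Rightarrow> bool" where
  "metric_structure A U g \<longleftrightarrow> smooth_field A U g \<and>
     (\<forall>p\<in>U. (\<forall>v w. g p v \<bullet> w = v \<bullet> g p w) \<and> det (matrix (blinfun_apply (g p))) \<noteq> 0)"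

definition metric_prod :: "('n canonical \<Rightarrow> 'n canonical) \<Rightarrow> 'n canonical \<Rightarrow> 'n::finite canonical \<Rightarrow> real" where
  "metric_prod G v w = G v \<bullet> w"

definition metric_adjoint ::
  "('n canonical \<Rightarrow> 'n canonical) \<Rightarrow> ('n canonical \<Rightarrow> 'n canonical) \<Rightarrow> 'n canonical \<Rightarrow> 'n::finite canonical" where
  "metric_adjoint G t =
     (THE s. linear s \<and> (\<forall>b c. metric_prod G (s b) c = metric_prod G b (t c)))"

definition metric_sym_part ::
  "('n canonical \<Rightarrow> 'n canonical) \<Rightarrow> ('n canonical \<Rightarrow> 'n canonical) \<Rightarrow> 'n canonical \<Rightarrow> 'n::finite canonical" where
  "metric_sym_part G t b = (1 / 2) *\<^sub>R (t b + metric_adjoint G t b)"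

definition metric_skew_part ::
  "('n canonical \<Rightarrow> 'n canonical) \<Rightarrow> ('n canonical \<Rightarrow> 'n canonical) \<Rightarrow> 'n canonical \<Rightarrow> 'n::finite canonical" where
  "metric_skew_part G t b = (1 / 2) *\<^sub>R (t b - metric_adjoint G t b)"

definition omega0 ::
  "('m, 'n::{finite,linorder}) chart \<Rightarrow> ('m \<Rightarrow> 'n canonical \<Rightarrow>\<^sub>L 'n canonical) \<Rightarrow> 'n canonical \<Rightarrow> 'm \<Rightarrow> 'n multivector" where
  "omega0 c g a p = - (1 / 4) *\<^sub>R (\<Sum>\<mu>\<in>UNIV. \<Sum>\<nu>\<in>UNIV.
     (a \<bullet> (endo_deriv c (basis_vec \<mu>) g (\<lambda>_. basis_vec \<nu>) p
         - endo_deriv c (basis_vec \<nu>) g (\<lambda>_. basis_vec \<mu>) p)) *\<^sub>R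
     wedge2 (inv (blinfun_apply (g p)) (basis_vec \<mu>)) (inv (blinfun_apply (g p)) (basis_vec \<nu>)))"

definition levi_civita ::
  "('m, 'n::{finite,linorder}) chart \<Rightarrow> ('m \<Rightarrow> 'n canonical \<Rightarrow>\<^sub>L 'n canonical) \<Rightarrow>
     'n canonical \<Rightarrow> ('m \<Rightarrow> 'n canonical) \<Rightarrow> 'm \<Rightarrow> 'n canonical" where
  "levi_civita c g a b p =
     (1 / 2) *\<^sub>R inv (blinfun_apply (g p)) (endo_deriv c a g b p)
     + bivector_cross (g p) (omega0 c g a p) (b p)"

text \<open>The endomorphism \<open>\<lambda>\<^sub>a\<close> of the canonical space at the point \<open>p\<close>; the value of
  \<open>levi_civita c g a b p\<close> depends on the vector field \<open>b\<close> through \<open>b p\<close> only.\<close>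

definition levi_civita_endo ::
  "('m, 'n::{finite,linorder}) chart \<Rightarrow> ('m \<Rightarrow> 'n canonical \<Rightarrow>\<^sub>L 'n canonical) \<Rightarrow>
     'n canonical \<Rightarrow> 'm \<Rightarrow> 'n canonical \<Rightarrow> 'n canonical" where
  "levi_civita_endo c g a p v = levi_civita c g a (\<lambda>_. v) p"

end

theory Submission
  imports Defs
begin

text \<open>
  Differentiating \<open>g(v) \<cdot> w = v \<cdot> g(w)\<close> shows that \<open>a \<cdot> \<partial>\<^sub>o g\<close> is Euclidean symmetric, so
  \<open>g\<^sup>-\<^sup>1 \<circ> (a \<cdot> \<partial>\<^sub>o g)\<close> is \<open>g\<close>-symmetric. The map \<open>b \<mapsto> B \<times>\<^sub>g b = - g(b) \<lrcorner> B\<close> is \<open>g\<close>-skew for every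
  bivector \<open>B\<close>, whatever the coefficients of \<open>\<omega>\<^sub>0(a)\<close> are. Hence the defining formula of \<open>\<lambda>\<^sub>a\<close>
  already is its decomposition into symmetric and skew parts.
\<close>

lemma chart_inv_chart:
  assumes "is_chart X c" "p \<in> fst c"
  shows "chart_inv c (snd c p) = p"
proof -
  have "fst c \<subseteq> topspace X"
    using assms(1) by (auto simp: is_chart_def dest: openin_subset)
  then have "inj_on (snd c) (fst c)"
    using assms(1) homeomorphic_imp_injective_map
    by (fastforce simp: is_chart_def Int_absorb1)
  then show ?thesis
    using assms(2) by (simp add: chart_inv_def)
qed

lemma open_chart_image:
  assumes "is_chart X c" "openin X U" "U \<subseteq> fst c"
  shows "open (snd c ` U)"
proof -
  have "openin (subtopology X (fst c)) U"
    using assms by (metis inf.absorb1 openin_subtopology_Int)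
  then have "openin (top_of_set (snd c ` fst c)) (snd c ` U)"
    using assms(1) homeomorphic_imp_open_map unfolding is_chart_def open_map_def by blast
  then show ?thesis
    using assms(1) by (auto simp: is_chart_def openin_open_eq)
qed

lemma smooth_on_imp_differentiable:
  assumes "smooth_on f S" "x \<in> S"
  shows "f differentiable at x"
proof -
  have "Ck_on (Suc 0) f S"
    using assms(1) unfolding smooth_on_def by blast
  then show ?thesis
    using assms(2) by simp
qed

lemma smooth_field_imp_differentiable:
  assumes "smooth_field A U f" "c \<in> A" "U \<subseteq> fst c" "p \<in> U"
  shows "(f \<circ> chart_inv c) differentiable at (snd c p)"
  using assms unfolding smooth_field_def by (blast intro: smooth_on_imp_differentiable)

text \<open>\<open>vector_derivative\<close> is an arbitrary value unless a derivative exists. The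
  chain rule along the coordinate line through \<open>p\<close> shows that it does exist.\<close>

lemma partial_deriv_works:
  fixes c :: "('m, 'n::finite) chart"
  assumes "(f \<circ> chart_inv c) differentiable at (snd c p)"
  shows "((\<lambda>t. f (chart_inv c (snd c p + t *\<^sub>R basis_vec \<mu>)))
    has_vector_derivative partial_deriv c \<mu> f p) (at 0)"
proof -
  let ?l = "\<lambda>t::real. snd c p + t *\<^sub>R (basis_vec \<mu> :: 'n canonical)"
  have "?l differentiable at 0"
    by (intro derivative_intros)
  then have "((f \<circ> chart_inv c) \<circ> ?l) differentiable at 0"
    using assms by (intro differentiable_chain_at) simp_all
  then have "(((f \<circ> chart_inv c) \<circ> ?l) has_vector_derivative
      vector_derivative ((f \<circ> chart_inv c) \<circ> ?l) (at 0)) (at 0)"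
    by (simp add: vector_derivative_works)
  then show ?thesis
    by (simp add: partial_deriv_def comp_def)
qed

text \<open>In the product rule for the pairing of \<open>g q\<close> with \<open>b q\<close>, the
  term that differentiates \<open>b\<close> cancels against the one subtracted in
  \<open>endo_deriv\<close>. What remains depends on the field \<open>b\<close> only through
  \<open>b p\<close>.\<close>

lemma endo_deriv_eq_dir_deriv:
  fixes c :: "('m, 'n::finite) chart"
  assumes g: "(g \<circ> chart_inv c) differentiable at (snd c p)"
    and b: "(b \<circ> chart_inv c) differentiable at (snd c p)"
    and p: "chart_inv c (snd c p) = p"
  shows "endo_deriv c a g b p = blinfun_apply (dir_deriv c a g p) (b p)"
proof -
  have "partial_deriv c \<mu> (\<lambda>q. g q (b q)) p
      = g p (partial_deriv c \<mu> b p) + partial_deriv c \<mu> g p (b p)" for \<mu>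
    using bounded_bilinear.has_vector_derivative[OF bounded_bilinear_blinfun_apply
        partial_deriv_works[OF g, of \<mu>] partial_deriv_works[OF b, of \<mu>]]
    by (simp add: p partial_deriv_def[of c \<mu> "\<lambda>q. g q (b q)"] vector_derivative_at)
  then show ?thesis
    by (simp add: endo_deriv_def dir_deriv_def blinfun.sum_left blinfun.sum_right
        blinfun.scaleR_left blinfun.scaleR_right scaleR_add_right sum.distrib)
qed

lemma partial_deriv_symmetric:
  fixes c :: "('m, 'n::finite) chart" and g :: "'m \<Rightarrow> 'n canonical \<Rightarrow>\<^sub>L 'n canonical"
  assumes g: "(g \<circ> chart_inv c) differentiable at (snd c p)"
    and V: "open V" "snd c p \<in> V"
    and sym: "\<And>x v w. x \<in> V \<Longrightarrow> g (chart_inv c x) v \<bullet> w = v \<bullet> g (chart_inv c x) w"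
  shows "partial_deriv c \<mu> g p v \<bullet> w = v \<bullet> partial_deriv c \<mu> g p w"
proof -
  let ?l = "\<lambda>t::real. snd c p + t *\<^sub>R (basis_vec \<mu> :: 'n canonical)"
  let ?h = "\<lambda>t. g (chart_inv c (?l t)) v \<bullet> w - v \<bullet> g (chart_inv c (?l t)) w"
  have "((\<lambda>t. g (chart_inv c (?l t)) u) has_vector_derivative partial_deriv c \<mu> g p u) (at 0)" for u
    by (rule bounded_linear.has_vector_derivative[OF bounded_bilinear.bounded_linear_left
          [OF bounded_bilinear_blinfun_apply] partial_deriv_works[OF g]])
  then have h: "(?h has_vector_derivative
      partial_deriv c \<mu> g p v \<bullet> w - v \<bullet> partial_deriv c \<mu> g p w) (at 0)"
    by (intro has_vector_derivative_diff
        bounded_linear.has_vector_derivative[OF bounded_linear_inner_left]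
        bounded_linear.has_vector_derivative[OF bounded_linear_inner_right])
  \<comment> \<open>\<open>?h\<close> vanishes while the coordinate line stays in \<open>V\<close>.
    Since this set of parameters is open and contains 0, that suffices for the derivative at
    0.\<close>
  have "open (?l -` V)"
    by (intro open_vimage V(1) continuous_intros)
  then have "(?h has_vector_derivative 0) (at 0)"
    using V(2) sym
    by (intro has_vector_derivative_transform_within_open[OF has_vector_derivative_const, of "?l -` V"])
      auto
  with h show ?thesis
    using vector_derivative_unique_at by force
qed

text \<open>Reduces statements about bivectors to wedges of two vectors. In the commutator
  \<open>B\<close> is also a right factor, but there the left factor is a vector, so
  \<open>clifford_prod_vec\<close> gives linearity.\<close>

lemma bivector_cross_linear_bivector:
  assumes "linear G"
  shows "linear (\<lambda>B. bivector_cross G B v)"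
proof (rule linearI)
  show "bivector_cross G (Y + Z) v = bivector_cross G Y v + bivector_cross G Z v" for Y Z
    by (simp add: bivector_cross_def commutator_prod_def clifford_prod_linear
        clifford_prod_vec[OF assms] clifford_vec_linear[OF assms] vec_part_def vec_eq_iff field_simps)
  show "bivector_cross G (r *\<^sub>R Z) v = r *\<^sub>R bivector_cross G Z v" for r Z
    by (simp add: bivector_cross_def commutator_prod_def clifford_prod_linear
        clifford_prod_vec[OF assms] clifford_vec_linear[OF assms] vec_part_def vec_eq_iff field_simps)
qed

lemma vec_part_minus: "vec_part (- Z) = - vec_part Z"
  by (simp add: vec_part_def vec_eq_iff)

lemma bivector_cross_wedge2:
  assumes "linear G" "\<And>v w. G v \<bullet> w = v \<bullet> G w"
  shows "bivector_cross G (wedge2 x y) v = (G v \<bullet> y) *\<^sub>R x - (G v \<bullet> x) *\<^sub>R y"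
  by (simp add: bivector_cross_def commutator_prod_wedge2[OF assms] left_contract_wedge2
      vec_part_minus)

text \<open>Linearity is included because \<open>metric_adjoint\<close> selects among linear maps
  only.\<close>

definition skew_endo :: "('n canonical \<Rightarrow> 'n canonical) \<Rightarrow> ('n canonical \<Rightarrow> 'n::finite canonical) \<Rightarrow> bool" where
  "skew_endo G t \<longleftrightarrow> linear t \<and> (\<forall>v w. metric_prod G (t v) w = - metric_prod G v (t w))"

text \<open>For \<open>B = wedge2 x y\<close>, symmetry of \<open>G\<close> turns the product of the
  image of \<open>v\<close> with \<open>w\<close> into \<open>(G v \<bullet> y) * (G w \<bullet> x)
  - (G v \<bullet> x) * (G w \<bullet> y)\<close>, which changes sign when \<open>v\<close> and
  \<open>w\<close> are exchanged. Skewness passes to linear combinations.\<close>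

lemma skew_endo_bivector_cross:
  assumes G: "linear G" "\<And>v w. G v \<bullet> w = v \<bullet> G w"
    and B: "B \<in> span {wedge2 x y | x y. True}"
  shows "skew_endo G (bivector_cross G B)"
  using B
proof (induction rule: span_induct_alt)
  case base
  have "bivector_cross G 0 v = 0" for v
    using linear_0[OF bivector_cross_linear_bivector[OF G(1)]] .
  then have "bivector_cross G 0 = (\<lambda>v. 0)" by blast
  then show ?case
    using linear_0[OF G(1)] by (simp add: skew_endo_def metric_prod_def linear_zero)
next
  case (step r X Y)
  then obtain x y where X: "X = wedge2 x y" by blast
  have eq: "bivector_cross G (r *\<^sub>R X + Y)
      = (\<lambda>v. r *\<^sub>R ((G v \<bullet> y) *\<^sub>R x - (G v \<bullet> x) *\<^sub>R y) + bivector_cross G Y v)"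
    using linear_add[OF bivector_cross_linear_bivector[OF G(1)]]
      linear_cmul[OF bivector_cross_linear_bivector[OF G(1)]]
    by (simp add: fun_eq_iff X bivector_cross_wedge2[OF G])
  have lin: "linear (\<lambda>v. r *\<^sub>R ((G v \<bullet> y) *\<^sub>R x - (G v \<bullet> x) *\<^sub>R y))"
    by (rule linearI) (simp_all add: linear_add[OF G(1)] linear_cmul[OF G(1)] algebra_simps)
  have Y: "linear (bivector_cross G Y)"
      "\<And>v w. G (bivector_cross G Y v) \<bullet> w = - (G v \<bullet> bivector_cross G Y w)"
    using step by (auto simp: skew_endo_def metric_prod_def)
  have swap: "G x \<bullet> w = G w \<bullet> x" "G y \<bullet> w = G w \<bullet> y" for w
    using G(2) by (metis inner_commute)+
  show ?case
    unfolding skew_endo_def eq metric_prod_def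
    using linear_compose_add[OF lin Y(1)]
    by (simp add: linear_add[OF G(1)] linear_cmul[OF G(1)] linear_diff[OF G(1)] Y(2) swap
        inner_add_left inner_add_right inner_diff_left inner_diff_right algebra_simps)
qed

lemma omega0_in_span: "omega0 c g a p \<in> span {wedge2 x y | x y. True}"
  unfolding omega0_def
  by (intro span_scale span_sum) (blast intro: span_base)

text \<open>The definite description needs uniqueness: two candidates become equal after applying
  \<open>G\<close>, as their images have the same inner product with every vector, and
  \<open>G\<close> is injective.\<close>

lemma metric_adjoint_eqI:
  assumes "linear G" "inj G" "linear s"
    and "\<And>b c. metric_prod G (s b) c = metric_prod G b (t c)"
  shows "metric_adjoint G t = s"
  unfolding metric_adjoint_def
proof (rule the_equality)
  fix s' assume s': "linear s' \<and> (\<forall>b c. metric_prod G (s' b) c = metric_prod G b (t c))"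
  have "G (s' b) = G (s b)" for b
    using s' assms(4) by (metis metric_prod_def vector_eq_ldot inner_commute)
  then show "s' = s"
    using assms(2) by (auto simp: inj_def)
qed (use assms in auto)

text \<open>The adjoint keeps \<open>S\<close> and negates \<open>K\<close>, so it is
  \<open>S - K\<close>; half the sum and half the difference with \<open>S + K\<close> return the
  two summands.\<close>

lemma metric_sym_skew_parts_of_sum:
  assumes G: "linear G" "inj G" "\<And>v w. G v \<bullet> w = v \<bullet> G w"
    and S: "linear S" "\<And>v w. metric_prod G (S v) w = metric_prod G v (S w)"
    and K: "skew_endo G K"
  shows "metric_sym_part G (\<lambda>v. S v + K v) = S"
    and "metric_skew_part G (\<lambda>v. S v + K v) = K"
proof -
  have "metric_adjoint G (\<lambda>v. S v + K v) = (\<lambda>v. S v - K v)"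
  proof (rule metric_adjoint_eqI[OF G(1,2)])
    show "linear (\<lambda>v. S v - K v)"
      using S(1) K by (auto simp: skew_endo_def intro: linear_compose_sub)
    show "metric_prod G (S b - K b) c = metric_prod G b (S c + K c)" for b c
      using S(2)[of b c] K
      by (simp add: skew_endo_def metric_prod_def linear_diff[OF G(1)] inner_diff_left inner_add_right)
  qed
  then show "metric_sym_part G (\<lambda>v. S v + K v) = S" "metric_skew_part G (\<lambda>v. S v + K v) = K"
    by (simp_all add: fun_eq_iff metric_sym_part_def metric_skew_part_def flip: scaleR_2)
qed

theorem mainTheorem6:
  fixes X :: "'m topology"
    and A :: "('m, 'n::{finite,linorder}) chart set"
    and c :: "('m, 'n) chart"
    and U :: "'m set"
    and g :: "'m \<Rightarrow> 'n canonical \<Rightarrow>\<^sub>L 'n canonical"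
    and a :: "'n canonical"
    and b :: "'m \<Rightarrow> 'n canonical"
    and p :: 'm
  assumes "smooth_manifold X A"
    and "c \<in> A"
    and "openin X U"
    and "U \<subseteq> fst c"
    and "metric_structure A U g"
    and "smooth_field A U b"
    and "p \<in> U"
  shows "metric_sym_part (g p) (levi_civita_endo c g a p) (b p)
           = (1 / 2) *\<^sub>R inv (blinfun_apply (g p)) (endo_deriv c a g b p) \<and>
         metric_skew_part (g p) (levi_civita_endo c g a p) (b p)
           = bivector_cross (g p) (omega0 c g a p) (b p)"
proof -
  let ?G = "blinfun_apply (g p)" and ?D = "blinfun_apply (dir_deriv c a g p)"
  let ?S = "\<lambda>v. (1 / 2) *\<^sub>R inv ?G (?D v)"
  let ?K = "bivector_cross ?G (omega0 c g a p)"
  have chart: "is_chart X c"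
    using assms(1,2) by (simp add: smooth_manifold_def)
  have inv: "chart_inv c (snd c q) = q" if "q \<in> U" for q
    using chart assms(4) that by (blast intro: chart_inv_chart)
  have sym: "g q v \<bullet> w = v \<bullet> g q w" if "q \<in> U" for q v w
    using assms(5) that by (simp add: metric_structure_def)
  have g: "(g \<circ> chart_inv c) differentiable at (snd c p)"
    using assms by (auto simp: metric_structure_def intro: smooth_field_imp_differentiable)
  have b: "(b \<circ> chart_inv c) differentiable at (snd c p)"
    using assms by (blast intro: smooth_field_imp_differentiable)
  have lin: "linear ?G"
    by (rule bounded_linear.linear[OF blinfun.bounded_linear_right])
  \<comment> \<open>Nonzero determinant gives injectivity, hence surjectivity by finite dimension,
    so that \<open>inv ?G\<close> is a two-sided inverse.\<close>
  have inj: "inj ?G"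
    using assms(5,7) det_nz_iff_inj[OF lin] by (simp add: metric_structure_def)
  then have surj: "surj ?G"
    using lin by (simp add: linear_injective_imp_surjective)
  \<comment> \<open>The neighbourhood on which symmetry is differentiated is the chart image of
    \<open>U\<close>.\<close>
  have "partial_deriv c \<mu> g p v \<bullet> w = v \<bullet> partial_deriv c \<mu> g p w" for \<mu> v w
    by (rule partial_deriv_symmetric[OF g open_chart_image[OF chart assms(3,4)]])
      (use assms(7) inv sym in auto)
  then have D: "?D v \<bullet> w = v \<bullet> ?D w" for v w
    by (simp add: dir_deriv_def blinfun.sum_left blinfun.scaleR_left inner_sum_left inner_sum_right)
  have deriv: "endo_deriv c a g f p = ?D (f p)" if "(f \<circ> chart_inv c) differentiable at (snd c p)" for f
    by (rule endo_deriv_eq_dir_deriv[OF g that inv[OF assms(7)]])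
  have linS: "linear ?S"
    using linear_compose[OF bounded_linear.linear[OF blinfun.bounded_linear_right]
        inj_linear_imp_inv_linear[OF lin inj]]
    by (intro linear_compose_scale_right) (simp add: comp_def)
  \<comment> \<open>Moving \<open>?G\<close> onto \<open>?S\<close> cancels its inverse on both
    sides, leaving the Euclidean symmetry of \<open>?D\<close>.\<close>
  have symS: "metric_prod ?G (?S v) w = metric_prod ?G v (?S w)" for v w
    using D[of v w] sym[OF assms(7)]
    by (simp add: metric_prod_def blinfun.scaleR_right surj_f_inv_f[OF surj])
  have skewK: "skew_endo ?G ?K"
    using lin sym[OF assms(7)] omega0_in_span by (rule skew_endo_bivector_cross)
  \<comment> \<open>\<open>deriv\<close> is applied here to constant fields, and to the field
    \<open>b\<close> in the conclusion; both give \<open>?D\<close> at the value in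
    \<open>p\<close>.\<close>
  have "levi_civita_endo c g a p = (\<lambda>v. ?S v + ?K v)"
    by (rule ext) (simp add: levi_civita_endo_def levi_civita_def deriv comp_def)
  then show ?thesis
    using metric_sym_skew_parts_of_sum[OF lin inj sym[OF assms(7)] linS symS skewK]
    by (simp add: deriv[OF b])
qed

end
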